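(* Let $\mathcal X$ be a finite set, $P\in\mathcal P(\mathcal X)$, $\mathcal Q_n\subseteq\mathcal P(\mathcal X^n)$ for $n\in\mathbb N$, and $\mathcal Q=\mathcal Q_1$. Suppose that Axioms 2, 3, 4 and 5 (stated in the context) hold on some open interval $J=(a,b)$ containing $1$. Then for any $r\in\mathbb R$, $$\lim_{n\to\infty}\hat\alpha\Big(\exp\big(-nD(P\|\mathcal Q)-\sqrt n\,r\big);P^{\times n}\Big\|\mathcal Q_n\Big)=\Phi\left(\frac{r}{\sqrt{V(P\|\mathcal Q)}}\right),$$ where $\Phi(x)=(2\pi)^{-1/2}\int_{-\infty}^xe^{-y^2/2}\,\mathrm dy$.
   Context: $\mathcal P(\mathcal X)$ is the set of probability mass functions (distributions) on the finite set $\mathcal X$; $P^{\times n}(x^n)=\prod_{i=1}^nP(x_i)$. $\log$ and $\exp$ are inverse to each other, in any fixed base. Hypothesis testing. For a test $T:\mathcal X^n\to[0,1]$ put $\alpha(T;P^{\times n})=\sum_{x^n}P^{\times n}(x^n)(1-T(x^n))$ and $\beta(T;\mathcal Q_n)=\sup_{Q\in\mathcal Q_n}\sum_{x^n}Q(x^n)T(x^n)$. Let $\hat\alpha(\mu;P^{\times n}\|\mathcal Q_n)=\min_T\{\alpha(T;P^{\times n}):\beta(T;\mathcal Q_n)\le\mu\}$. Rényi divergence. For $s\in(0,1)\cup(1,\infty)$, $g_s(P\|Q)=\sum_{x:P(x)>0}P(x)^sQ(x)^{1-s}$ (equal to $+\infty$ if $s>1$ and $Q(x)=0<P(x)$ for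 some $x$), $D_s(P\|Q)=\frac{1}{s-1}\log g_s(P\|Q)$, and $D_1(P\|Q)=D(P\|Q)=\sum_xP(x)(\log P(x)-\log Q(x))$. For a set, $D_s(P\|\mathcal Q)=\inf_{Q\in\mathcal Q}D_s(P\|Q)$ and $D(P\|\mathcal Q)=D_1(P\|\mathcal Q)$. Variance. $V(P\|Q)=\sum_xP(x)\big(\log P(x)-\log Q(x)-D(P\|Q)\big)^2$ and $V(P\|\mathcal Q)=V(P\|\hat Q^1)$, where $\hat Q^1=Q_{\hat\theta^1}$ is the minimizer of $D(P\|Q)$ over $Q\in\mathcal Q$ (see Axiom 5). Permutations. $S_n$ acts on $\mathcal P(\mathcal X^n)$ by $(P^nW^n[\pi])(x_1,\dots,x_n)=P^n(x_{\pi(1)},\dots,x_{\pi(n)})$; $\mathcal P^{\rm sym}(\mathcal X^n)$ is the set of invariant distributions and $\mathcal Q_n^{\rm sym}=\mathcal Q_n\cap\mathcal P^{\rm sym}(\mathcal X^n)$. Axioms on an interval $J$ containing $1$: Axiom 2: $Q^{\times n}\in\mathcal Q_n$ for every $Q\in\mathcal Q$ and $n\in\mathbb N$. Axiom 3: $D_s(P^{\times n}\|\mathcal Q_n)\ge nD_s(P\|\mathcal Q)$ for all $s\in J$, $n\in\mathbb N$. Axiom 4: there are $U^n\in\mathcal P^{\rm sym}(\mathcal X^n)$, $n\in\mathbb N$, and a polynomial $v(n)$ such that for all $n$: $Q(x^n)\le v(n)U^n(x^n)$ for all $Q\in\mathcal Q_n^{\rm sym}$ and $x^n\in\mathcal X^n$;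 and $D_s(P^{\times n}\|U^n)\ge D_s(P^{\times n}\|\mathcal Q_n)$ for all $s\in J$. Moreover, $P^n\in\mathcal Q_n$ implies $\frac1{n!}\sum_{\pi\in S_n}P^nW^n[\pi]\in\mathcal Q_n^{\rm sym}$. Axiom 5: there is a compact convex set $\Theta$ in a finite-dimensional vector space and a $C^2$ map $\theta\mapsto Q_\theta$ with $\mathcal Q=\{Q_\theta:\theta\in\Theta\}$ such that: for all $s\in J$ the minimizer $\hat\theta^s=\arg\min_{\theta\in\Theta}D_s(P\|Q_\theta)$ is unique and lies in the relative interior of $\Theta$; the map $\theta\mapsto g_s(P\|Q_\theta)$ has negative definite Hessian at $\hat\theta^s$ for all $s\in J$ with $s<1$ and positive definite Hessian at $\hat\theta^s$ for all $s\in J$ with $s>1$; and $\theta\mapsto D_1(P\|Q_\theta)$ has positive definite Hessian at $\hat\theta^1$.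
   Formalization: The case V(P‖Q) = 0 and r = 0, where r/√V is the undefined 0/0, is excluded (with Q_n = {P^n} the left side is 0 there); for V = 0 and r ≠ 0 the quotient is read as ±∞, so Φ is 1 or 0. *)

theory Defs
  imports
    "HOL-Probability.Probability"
    "HOL-Combinatorics.Permutations"
begin

text \<open>
  The alphabet is a finite type, sequences of length \<open>n\<close> are lists, and distributions on
  sequences of length \<open>n\<close> are probability mass functions on lists concentrated on \<open>words n\<close>.
\<close>

definition words :: "nat \<Rightarrow> 'a list set" where
  "words n = {xs. length xs = n}"

definition dists :: "nat \<Rightarrow> 'a list pmf set" where
  "dists n = {p. set_pmf p \<subseteq> words n}"

lemma finite_words: "finite (words n :: 'a::finite list set)"
  using finite_lists_length_eq[of "UNIV :: 'a set" n] by (simp add: words_def)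

text \<open>The distributions on single letters whose one-letter words are distributed as in \<open>S\<close>.\<close>

definition single_letter :: "'a list pmf set \<Rightarrow> 'a pmf set" where
  "single_letter S = {Q. map_pmf (\<lambda>x. [x]) Q \<in> S}"

text \<open>Product distributions are given by \<^const>\<open>replicate_pmf\<close>.\<close>

lemma pmf_replicate_pmf:
  "pmf (replicate_pmf (length xs) P) xs = (\<Prod>x\<leftarrow>xs. pmf P x)"
proof (induction xs)
  case Nil
  then show ?case by simp
next
  case (Cons x xs)
  have inj: "inj (\<lambda>(x, xs). x # xs :: 'a list)"
    by (auto simp: inj_def)
  have "replicate_pmf (length (x # xs)) P =
      map_pmf (\<lambda>(x, xs). x # xs) (pair_pmf P (replicate_pmf (length xs) P))"
    by (simp add: pair_pmf_def map_bind_pmf)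
  then have "pmf (replicate_pmf (length (x # xs)) P) (x # xs) =
      pmf (pair_pmf P (replicate_pmf (length xs) P)) (x, xs)"
    using pmf_map_inj'[OF inj, of _ "(x, xs)"] by simp
  then show ?case
    using Cons by (simp add: pmf_pair)
qed


subsection \<open>Permutations of the positions\<close>

definition perm_act :: "(nat \<Rightarrow> nat) \<Rightarrow> 'a list pmf \<Rightarrow> 'a list pmf" where
  "perm_act \<pi> p = map_pmf (permute_list (inv \<pi>)) p"

lemma pmf_perm_act:
  assumes "p \<in> dists n" "\<pi> permutes {..<n}" "length xs = n"
  shows "pmf (perm_act \<pi> p) xs = pmf p (permute_list \<pi> xs)"
proof -
  have inv: "inv \<pi> permutes {..<n}"
    using assms(2) by (rule permutes_inv)
  have A: "permute_list \<pi> (permute_list (inv \<pi>) ys) = ys" if "length ys = n" for ys :: "'a list"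
  proof -
    have "permute_list (inv \<pi> \<circ> \<pi>) ys = permute_list \<pi> (permute_list (inv \<pi>) ys)"
      using assms(2) that by (intro permute_list_compose) simp
    then show ?thesis
      by (simp only: permutes_inv_o(2)[OF assms(2)] permute_list_id)
  qed
  have B: "permute_list (inv \<pi>) (permute_list \<pi> ys) = ys" if "length ys = n" for ys :: "'a list"
  proof -
    have "permute_list (\<pi> \<circ> inv \<pi>) ys = permute_list (inv \<pi>) (permute_list \<pi> ys)"
      using inv that by (intro permute_list_compose) simp
    then show ?thesis
      by (simp only: permutes_inv_o(1)[OF assms(2)] permute_list_id)
  qed
  have sub: "set_pmf p \<subseteq> {ys. length ys = n}"
    using assms(1) by (simp add: dists_def words_def)
  have "pmf (perm_act \<pi> p) xs = measure p (permute_list (inv \<pi>) -` {xs})"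
    by (simp add: perm_act_def pmf_map)
  also have "\<dots> = measure p (permute_list (inv \<pi>) -` {xs} \<inter> set_pmf p)"
    by (simp add: measure_Int_set_pmf)
  also have "permute_list (inv \<pi>) -` {xs} \<inter> set_pmf p = {permute_list \<pi> xs} \<inter> set_pmf p"
  proof (intro set_eqI iffI)
    fix ys assume "ys \<in> permute_list (inv \<pi>) -` {xs} \<inter> set_pmf p"
    then have "permute_list (inv \<pi>) ys = xs" "ys \<in> set_pmf p" "length ys = n"
      using sub by auto
    then show "ys \<in> {permute_list \<pi> xs} \<inter> set_pmf p"
      using A[of ys] by auto
  next
    fix ys assume "ys \<in> {permute_list \<pi> xs} \<inter> set_pmf p"
    then show "ys \<in> permute_list (inv \<pi>) -` {xs} \<inter> set_pmf p"
      using B[OF assms(3)] by auto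
  qed
  also have "measure p \<dots> = measure p {permute_list \<pi> xs}"
    by (simp add: measure_Int_set_pmf)
  finally show ?thesis
    by (simp add: measure_pmf_single)
qed

definition sym_dists :: "nat \<Rightarrow> 'a list pmf set" where
  "sym_dists n = {p \<in> dists n. \<forall>\<pi>. \<pi> permutes {..<n} \<longrightarrow> perm_act \<pi> p = p}"

definition symmetrize :: "nat \<Rightarrow> 'a list pmf \<Rightarrow> 'a list pmf" where
  "symmetrize n p = pmf_of_set {\<pi>. \<pi> permutes {..<n}} \<bind> (\<lambda>\<pi>. perm_act \<pi> p)"

lemma pmf_symmetrize:
  "pmf (symmetrize n p) xs = (1 / fact n) * (\<Sum>\<pi> | \<pi> permutes {..<n}. pmf (perm_act \<pi> p) xs)"
proof -
  have fin: "finite {\<pi>. \<pi> permutes {..<n}}"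
    by (simp add: finite_permutations)
  have "id \<in> {\<pi>. \<pi> permutes {..<n}}"
    by (simp add: permutes_id)
  then have ne: "{\<pi>. \<pi> permutes {..<n}} \<noteq> {}"
    by blast
  have card: "card {\<pi>. \<pi> permutes {..<n}} = fact n"
    by (rule card_permutations) auto
  show ?thesis
    unfolding symmetrize_def pmf_bind
    by (subst integral_pmf_of_set[OF ne fin]) (simp add: card)
qed


subsection \<open>Hypothesis testing\<close>

definition tests :: "nat \<Rightarrow> ('a list \<Rightarrow> real) set" where
  "tests n = {T. \<forall>xs \<in> words n. 0 \<le> T xs \<and> T xs \<le> 1}"

definition type1_error :: "nat \<Rightarrow> ('a list \<Rightarrow> real) \<Rightarrow> 'a list pmf \<Rightarrow> real" where
  "type1_error n T p = (\<Sum>xs \<in> words n. pmf p xs * (1 - T xs))"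

definition type2_error :: "nat \<Rightarrow> ('a list \<Rightarrow> real) \<Rightarrow> 'a list pmf set \<Rightarrow> real" where
  "type2_error n T S = (SUP q \<in> S. \<Sum>xs \<in> words n. pmf q xs * T xs)"

text \<open>The infimum is attained, see \<open>opt_type1_error_attained\<close>.\<close>

definition opt_type1_error :: "nat \<Rightarrow> real \<Rightarrow> 'a list pmf \<Rightarrow> 'a list pmf set \<Rightarrow> real" where
  "opt_type1_error n \<mu> p S = (INF T \<in> {T \<in> tests n. type2_error n T S \<le> \<mu>}. type1_error n T p)"

lemma opt_type1_error_attained:
  fixes p :: "'a::finite list pmf"
  assumes S: "S \<noteq> {}" and "\<mu> \<ge> 0"
  shows "\<exists>T \<in> tests n. type2_error n T S \<le> \<mu> \<and> type1_error n T p = opt_type1_error n \<mu> p S"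
proof -
  have fin: "finite (words n :: 'a list set)"
    by (rule finite_words)
  define B :: "'a list \<Rightarrow> real set" where "B xs = (if xs \<in> words n then {0..1} else {0})" for xs
  define K where "K = PiE UNIV B"
  define C where "C = K \<inter> (\<Inter>q\<in>S. {T. (\<Sum>xs\<in>words n. pmf q xs * T xs) \<le> \<mu>})"
  have "compactin (product_topology (\<lambda>_. euclidean) UNIV) (PiE UNIV B)"
    by (subst compactin_PiE) (auto simp: B_def)
  then have K: "compact K"
    by (simp add: K_def euclidean_product_topology)
  have coord: "continuous_on A (\<lambda>T. T xs)" for A :: "('a list \<Rightarrow> real) set" and xs
    by (rule continuous_on_subset[OF continuous_on_product_coordinates]) auto
  have "closed {T. (\<Sum>xs\<in>words n. pmf q xs * T xs) \<le> \<mu>}" for q :: "'a list pmf"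
    by (intro closed_Collect_le continuous_intros coord)
  then have C: "compact C"
    unfolding C_def by (intro compact_Int_closed K closed_INT) auto
  have "(\<lambda>_. 0) \<in> C"
    using \<open>\<mu> \<ge> 0\<close> by (auto simp: C_def K_def B_def)
  then have "C \<noteq> {}"
    by blast
  moreover have "continuous_on C (\<lambda>T. type1_error n T p)"
    unfolding type1_error_def by (intro continuous_intros coord)
  ultimately obtain T where T: "T \<in> C" "\<And>T'. T' \<in> C \<Longrightarrow> type1_error n T p \<le> type1_error n T' p"
    using continuous_attains_inf[OF C] by metis
  have le_iff: "type2_error n T' S \<le> \<mu> \<longleftrightarrow> (\<forall>q\<in>S. (\<Sum>xs\<in>words n. pmf q xs * T' xs) \<le> \<mu>)"
    if "T' \<in> tests n" for T'
  proof -
    have "(\<Sum>xs\<in>words n. pmf q xs * T' xs) \<le> 1" for q :: "'a list pmf"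
    proof -
      have "(\<Sum>xs\<in>words n. pmf q xs * T' xs) \<le> (\<Sum>xs\<in>words n. pmf q xs)"
        using that by (intro sum_mono mult_left_le) (auto simp: tests_def)
      also have "\<dots> \<le> 1"
        using fin by (simp flip: measure_measure_pmf_finite)
      finally show ?thesis .
    qed
    then have "bdd_above ((\<lambda>q. \<Sum>xs\<in>words n. pmf q xs * T' xs) ` S)"
      by (intro bdd_aboveI2)
    then show ?thesis
      unfolding type2_error_def by (rule cSUP_le_iff[OF S])
  qed
  have TC: "T \<in> tests n"
  proof -
    have B: "T xs \<in> B xs" for xs
      using T(1) by (auto simp: C_def K_def)
    have "T xs \<in> {0..1}" if "xs \<in> words n" for xs
      using B[of xs] that by (simp add: B_def)
    then show ?thesis
      by (simp add: tests_def)
  qed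
  have T2: "type2_error n T S \<le> \<mu>"
    using T(1) by (auto simp: le_iff[OF TC] C_def)
  have min: "type1_error n T p \<le> type1_error n T' p" if T': "T' \<in> tests n" "type2_error n T' S \<le> \<mu>" for T'
  proof -
    define T'' where "T'' xs = (if xs \<in> words n then T' xs else 0)" for xs
    have eq: "(\<Sum>xs\<in>words n. pmf q xs * T'' xs) = (\<Sum>xs\<in>words n. pmf q xs * T' xs)" for q
      by (rule sum.cong) (auto simp: T''_def)
    have eq': "type1_error n T'' p = type1_error n T' p"
      unfolding type1_error_def by (rule sum.cong) (auto simp: T''_def)
    have "T'' \<in> C"
    proof -
      have "T'' \<in> K"
        using T'(1) by (auto simp: K_def B_def T''_def tests_def)
      moreover have "(\<Sum>xs\<in>words n. pmf q xs * T'' xs) \<le> \<mu>" if "q \<in> S" for q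
        unfolding eq using T'(2) le_iff[OF T'(1)] that by blast
      ultimately show ?thesis
        unfolding C_def by blast
    qed
    then show ?thesis
      using T(2) eq' by metis
  qed
  have "opt_type1_error n \<mu> p S = type1_error n T p"
    unfolding opt_type1_error_def
    using TC T2 min by (intro cInf_eq_minimum) auto
  then show ?thesis
    using TC T2 by metis
qed


subsection \<open>Divergences\<close>

text \<open>Logarithm to base \<open>b\<close> on the extended reals, with values \<open>-\<infinity>\<close> at \<open>0\<close> and \<open>\<infinity>\<close> at \<open>\<infinity>\<close>.\<close>

definition elog :: "real \<Rightarrow> ereal \<Rightarrow> ereal" where
  "elog b y = (if y = \<infinity> then \<infinity> else if y \<le> 0 then -\<infinity> else ereal (log b (real_of_ereal y)))"

text \<open>
  The sums below run over the support of \<open>P\<close>, which is finite in all uses.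
\<close>

definition renyi_sum :: "real \<Rightarrow> 'b pmf \<Rightarrow> 'b pmf \<Rightarrow> ereal" where
  "renyi_sum s P Q =
    (if s > 1 \<and> (\<exists>x \<in> set_pmf P. pmf Q x = 0) then \<infinity>
     else ereal (\<Sum>x \<in> set_pmf P. pmf P x powr s * pmf Q x powr (1 - s)))"

definition renyi_div :: "real \<Rightarrow> real \<Rightarrow> 'b pmf \<Rightarrow> 'b pmf \<Rightarrow> ereal" where
  "renyi_div b s P Q =
    (if s = 1
     then (\<Sum>x \<in> set_pmf P. ereal (pmf P x) * (elog b (ereal (pmf P x)) - elog b (ereal (pmf Q x))))
     else ereal (1 / (s - 1)) * elog b (renyi_sum s P Q))"

definition renyi_div_set :: "real \<Rightarrow> real \<Rightarrow> 'b pmf \<Rightarrow> 'b pmf set \<Rightarrow> ereal" where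
  "renyi_div_set b s P S = (INF Q \<in> S. renyi_div b s P Q)"

text \<open>Meaningful only if the relative entropy is finite.\<close>

definition info_variance :: "real \<Rightarrow> 'b pmf \<Rightarrow> 'b pmf \<Rightarrow> real" where
  "info_variance b P Q =
    (\<Sum>x \<in> set_pmf P.
      pmf P x * (log b (pmf P x) - log b (pmf Q x) - real_of_ereal (renyi_div b 1 P Q))\<^sup>2)"

definition info_variance_set :: "real \<Rightarrow> 'b pmf \<Rightarrow> 'b pmf set \<Rightarrow> real" where
  "info_variance_set b P S =
    info_variance b P (arg_min (\<lambda>Q. renyi_div b 1 P Q) (\<lambda>Q. Q \<in> S))"


subsection \<open>Smoothness on convex sets\<close>

text \<open>
  A convex set may have empty interior. Derivatives are therefore taken within the set; gradients
  \<open>G\<close> and Hessians \<open>H\<close> are then only determined along the directions tangent to the set, and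
  definiteness of a Hessian is only required on those directions.
\<close>

definition C2_on :: "('v::euclidean_space \<Rightarrow> real) \<Rightarrow> 'v set \<Rightarrow> bool" where
  "C2_on f S \<longleftrightarrow>
    (\<exists>(G :: 'v \<Rightarrow> 'v) (H :: 'v \<Rightarrow> 'v \<Rightarrow>\<^sub>L 'v).
      (\<forall>t \<in> S. (f has_derivative (\<lambda>h. G t \<bullet> h)) (at t within S) \<and>
               (G has_derivative blinfun_apply (H t)) (at t within S)) \<and>
      continuous_on S H)"

definition direction_space :: "'v::euclidean_space set \<Rightarrow> 'v set" where
  "direction_space S = span {x - y | x y. x \<in> S \<and> y \<in> S}"

text \<open>
  An extended real function has Hessian \<open>H\<close> at \<open>t\<close> if near \<open>t\<close> it is finite and
  differentiable, and its gradient is differentiable at \<open>t\<close> with derivative \<open>H\<close>.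
\<close>

definition has_hessian_within ::
    "('v::euclidean_space \<Rightarrow> ereal) \<Rightarrow> ('v \<Rightarrow> 'v) \<Rightarrow> 'v \<Rightarrow> 'v set \<Rightarrow> bool" where
  "has_hessian_within f H t S \<longleftrightarrow>
    (\<exists>e>0. \<exists>(F :: 'v \<Rightarrow> real) (G :: 'v \<Rightarrow> 'v).
      (\<forall>u \<in> S \<inter> ball t e. f u = ereal (F u) \<and> (F has_derivative (\<lambda>h. G u \<bullet> h)) (at u within S)) \<and>
      (G has_derivative H) (at t within S))"

definition pos_def_hessian :: "('v::euclidean_space \<Rightarrow> ereal) \<Rightarrow> 'v \<Rightarrow> 'v set \<Rightarrow> bool" where
  "pos_def_hessian f t S \<longleftrightarrow>
    (\<exists>H. has_hessian_within f H t S \<and> (\<forall>u \<in> direction_space S - {0}. u \<bullet> H u > 0))"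

definition neg_def_hessian :: "('v::euclidean_space \<Rightarrow> ereal) \<Rightarrow> 'v \<Rightarrow> 'v set \<Rightarrow> bool" where
  "neg_def_hessian f t S \<longleftrightarrow>
    (\<exists>H. has_hessian_within f H t S \<and> (\<forall>u \<in> direction_space S - {0}. u \<bullet> H u < 0))"


subsection \<open>The axioms on the families of alternative hypotheses\<close>

definition contains_products :: "(nat \<Rightarrow> 'a list pmf set) \<Rightarrow> bool" where
  "contains_products Qn \<longleftrightarrow> (\<forall>Q \<in> single_letter (Qn 1). \<forall>n\<ge>1. replicate_pmf n Q \<in> Qn n)"

definition superadditive_div ::
    "real \<Rightarrow> real set \<Rightarrow> 'a pmf \<Rightarrow> (nat \<Rightarrow> 'a list pmf set) \<Rightarrow> bool" where
  "superadditive_div b J P Qn \<longleftrightarrow>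
    (\<forall>s \<in> J. \<forall>n\<ge>1. renyi_div_set b s (replicate_pmf n P) (Qn n)
        \<ge> ereal (real n) * renyi_div_set b s P (single_letter (Qn 1)))"

definition has_universal_dist ::
    "real \<Rightarrow> real set \<Rightarrow> 'a pmf \<Rightarrow> (nat \<Rightarrow> 'a list pmf set) \<Rightarrow> bool" where
  "has_universal_dist b J P Qn \<longleftrightarrow>
    (\<exists>(U :: nat \<Rightarrow> 'a list pmf) (v :: real poly). \<forall>n\<ge>1.
      U n \<in> sym_dists n \<and>
      (\<forall>Q \<in> Qn n \<inter> sym_dists n. \<forall>xs \<in> words n. pmf Q xs \<le> poly v (real n) * pmf (U n) xs) \<and>
      (\<forall>s \<in> J. renyi_div b s (replicate_pmf n P) (U n)
          \<ge> renyi_div_set b s (replicate_pmf n P) (Qn n))) \<and>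
    (\<forall>n\<ge>1. \<forall>p \<in> Qn n. symmetrize n p \<in> Qn n \<inter> sym_dists n)"

definition regular_parametrization ::
    "real \<Rightarrow> real set \<Rightarrow> 'a pmf \<Rightarrow> 'a pmf set \<Rightarrow> 'v::euclidean_space set \<Rightarrow> ('v \<Rightarrow> 'a pmf) \<Rightarrow> bool"
where
  "regular_parametrization b J P S \<Theta> Q \<longleftrightarrow>
    compact \<Theta> \<and> convex \<Theta> \<and>
    (\<forall>x. C2_on (\<lambda>\<theta>. pmf (Q \<theta>) x) \<Theta>) \<and>
    S = Q ` \<Theta> \<and>
    (\<forall>s \<in> J. \<exists>t \<in> rel_interior \<Theta>.
      (\<forall>t'. is_arg_min (\<lambda>\<theta>. renyi_div b s P (Q \<theta>)) (\<lambda>\<theta>. \<theta> \<in> \<Theta>) t' \<longleftrightarrow> t' = t) \<and>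
      (s < 1 \<longrightarrow> neg_def_hessian (\<lambda>\<theta>. renyi_sum s P (Q \<theta>)) t \<Theta>) \<and>
      (s > 1 \<longrightarrow> pos_def_hessian (\<lambda>\<theta>. renyi_sum s P (Q \<theta>)) t \<Theta>) \<and>
      (s = 1 \<longrightarrow> pos_def_hessian (\<lambda>\<theta>. renyi_div b 1 P (Q \<theta>)) t \<Theta>))"


subsection \<open>Gaussian distribution function\<close>

text \<open>
  The argument is an extended real so that it can be a quotient with denominator \<open>0\<close>: for
  \<open>r \<noteq> 0\<close> the quotient \<open>ereal r / 0\<close> is \<open>\<infinity>\<close> or \<open>-\<infinity>\<close> according to the sign of \<open>r\<close>, with
  values \<open>1\<close> and \<open>0\<close> of the distribution function.
\<close>

definition gauss_cdf :: "ereal \<Rightarrow> real" where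
  "gauss_cdf z = (1 / sqrt (2 * pi)) * (LBINT y=-\<infinity>..z. exp (- y\<^sup>2 / 2))"

end

(*
  Let R be the minimizer of D(P||Q) over Q and let L_n = log (P^n / R^n). Since R^n lies in Q_n, the
  Neyman-Pearson bound for P^n against R^n gives the lower bound on the error. For the upper
  bound, threshold L'_n = log (P^n / U^n): a permutation invariant test has probability at most
  v(n) U^n(T) under every element of Q_n. Axiom 4 gives L'_n <= L_n + log v(n), while Axioms 3
  and 4 at s = 1 give E L'_n >= n D = E L_n. So L_n + log v(n) - L'_n is nonnegative with mean at most
  log v(n) = o(sqrt n), hence negligible by Markov's inequality, and both bounds reduce to the
  central limit theorem for L_n.
*)
theory Submission
  imports Defs "HOL-Real_Asymp.Real_Asymp"
begin

text \<open>The obstacle is that log (P^n / U^n) is not a sum of independent terms, and domination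
  of Q_n by U^n bounds it from above only, whereas the error of a threshold test needs it not to be
  much smaller than L_n. A bound on its mean closes the gap because the difference has a sign. All
  losses are paid for by moving the threshold by sqrt n * eps with eps fixed while n grows. On this
  scale the Neyman-Pearson slack b^(-sqrt n * eps) and the Markov term log v(n) / (sqrt n * eps)
  both vanish; only afterwards does eps shrink, using continuity of the limit in r. If V = 0 there
  is nothing to normalise: L_n is constant on the support and the limit is a step function of r with
  its jump at 0. This case is carried along by working near a point r different from 0.\<close>

section \<open>Central limit theorem for words of independent letters\<close>

text \<open>The central limit theorem speaks of one infinite sequence of independent variables on a
  single space, while the words of each length n live on a space of their own. Reading a word as a
  prefix of an infinite sequence connects the two.\<close>

lemma measure_replicate_pmf_conv_PiM:
  fixes P :: "'a::finite pmf"
  shows "measure (replicate_pmf n P) A =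
    measure (PiM UNIV (\<lambda>_::nat. measure_pmf P)) {\<omega>. map \<omega> [0..<n] \<in> A}"
proof -
  let ?M = "PiM UNIV (\<lambda>_::nat. measure_pmf P)"
  interpret product_prob_space "\<lambda>_::nat. measure_pmf P" UNIV
    by unfold_locales
  \<comment> \<open>\<open>A\<close> may contain words of any length; those of length n are finitely
    many, so the event is a finite union of cylinders.\<close>
  define B where "B = A \<inter> words n"
  have fin: "finite B"
    unfolding B_def using finite_words by blast
  have point: "{\<omega>. map \<omega> [0..<n] = xs} \<in> sets ?M \<and>
      measure ?M {\<omega>. map \<omega> [0..<n] = xs} = pmf (replicate_pmf n P) xs" if "xs \<in> B" for xs
  proof -
    have len: "length xs = n"
      using that by (simp add: B_def words_def)
    have eq: "{\<omega>. map \<omega> [0..<n] = xs} = prod_emb UNIV (\<lambda>_. measure_pmf P) {..<n} (\<Pi>\<^sub>E i\<in>{..<n}. {xs ! i})"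
    proof (rule set_eqI)
      fix \<omega> :: "nat \<Rightarrow> 'a"
      have "map \<omega> [0..<n] = xs \<longleftrightarrow> (\<forall>i<n. \<omega> i = xs ! i)"
        using len by (simp add: list_eq_iff_nth_eq)
      also have "\<dots> \<longleftrightarrow> restrict \<omega> {..<n} \<in> (\<Pi>\<^sub>E i\<in>{..<n}. {xs ! i})"
        by (auto simp: PiE_iff)
      finally show "\<omega> \<in> {\<omega>. map \<omega> [0..<n] = xs} \<longleftrightarrow>
          \<omega> \<in> prod_emb UNIV (\<lambda>_. measure_pmf P) {..<n} (\<Pi>\<^sub>E i\<in>{..<n}. {xs ! i})"
        by (simp add: prod_emb_def)
    qed
    have "measure ?M {\<omega>. map \<omega> [0..<n] = xs} = (\<Prod>i<n. pmf P (xs ! i))"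
      unfolding eq by (subst measure_PiM_emb) (auto simp: measure_pmf_single)
    also have "\<dots> = pmf (replicate_pmf n P) xs"
      using pmf_replicate_pmf[of xs P] len
      by (simp add: prod.list_conv_set_nth atLeast0LessThan)
    finally show ?thesis
      unfolding eq by (auto intro!: sets_PiM_I_finite sets_PiM_I)
  qed
  have "measure (replicate_pmf n P) A = measure (replicate_pmf n P) B"
  proof -
    have "A \<inter> set_pmf (replicate_pmf n P) = B \<inter> set_pmf (replicate_pmf n P)"
      by (auto simp: B_def words_def set_replicate_pmf)
    then show ?thesis
      by (metis measure_Int_set_pmf)
  qed
  also have "\<dots> = (\<Sum>xs\<in>B. pmf (replicate_pmf n P) xs)"
    by (rule measure_measure_pmf_finite[OF fin])
  also have "\<dots> = (\<Sum>xs\<in>B. measure ?M {\<omega>. map \<omega> [0..<n] = xs})"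
    using point by simp
  also have "\<dots> = measure ?M (\<Union>xs\<in>B. {\<omega>. map \<omega> [0..<n] = xs})"
    by (rule P.finite_measure_finite_Union[symmetric]) (use fin point in \<open>auto simp: disjoint_family_on_def\<close>)
  also have "(\<Union>xs\<in>B. {\<omega>. map \<omega> [0..<n] = xs}) = {\<omega>. map \<omega> [0..<n] \<in> A}"
    by (auto simp: B_def words_def)
  finally show ?thesis .
qed

lemma isCont_cdf_std_normal: "isCont (cdf std_normal_distribution) x"
proof -
  interpret real_distribution std_normal_distribution
    by (rule real_dist_normal_dist)
  show ?thesis
    unfolding isCont_cdf by (simp add: measure_def emeasure_density)
qed

lemma replicate_pmf_central_limit:
  fixes P :: "'a::finite pmf" and f :: "'a \<Rightarrow> real"
  defines "m \<equiv> \<Sum>x\<in>set_pmf P. pmf P x * f x"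
  defines "V \<equiv> \<Sum>x\<in>set_pmf P. pmf P x * (f x - m)\<^sup>2"
  assumes "V > 0"
  shows "(\<lambda>n. measure (replicate_pmf n P) {xs. (\<Sum>x\<leftarrow>xs. f x) \<le> real n * m + sqrt (real n) * r})
    \<longlonglongrightarrow> cdf std_normal_distribution (r / sqrt V)"
proof -
  let ?M = "PiM UNIV (\<lambda>_::nat. measure_pmf P)"
  interpret product_prob_space "\<lambda>_::nat. measure_pmf P" UNIV
    by unfold_locales
  have comp: "distr ?M (measure_pmf P) (\<lambda>\<omega>. \<omega> i) = measure_pmf P" for i
    by (rule PiM_component) auto
  have meas: "(\<lambda>\<omega>. \<omega> i) \<in> measurable ?M (measure_pmf P)" for i
    by (rule measurable_component_singleton) auto
  \<comment> \<open>The joint law of all coordinates is the image of \<open>?M\<close> under the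
    identity, hence the product of the marginals.\<close>
  have ind0: "P.indep_vars (\<lambda>_. measure_pmf P) (\<lambda>i \<omega>. \<omega> i) UNIV"
    by (subst P.indep_vars_iff_distr_eq_PiM) (auto simp: comp meas restrict_UNIV intro!: distr_id2)
  have ind: "P.indep_vars (\<lambda>_. borel) (\<lambda>i \<omega>. f (\<omega> i)) UNIV"
    by (rule P.indep_vars_compose2[OF ind0]) auto
  have E: "P.expectation (\<lambda>\<omega>. g (\<omega> i)) = (\<Sum>x\<in>set_pmf P. pmf P x * g x)" for i and g :: "'a \<Rightarrow> real"
  proof -
    have "P.expectation (\<lambda>\<omega>. g (\<omega> i)) = measure_pmf.expectation P g"
      by (subst comp[of i, symmetric], subst integral_distr) (auto simp: meas)
    then show ?thesis
      by (subst (asm) integral_measure_pmf_real[of "set_pmf P"]) (auto simp: mult.commute set_pmf_iff)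
  qed
  have int: "integrable ?M (\<lambda>\<omega>. g (\<omega> i))" for i and g :: "'a \<Rightarrow> real"
  proof -
    have "integrable (distr ?M (measure_pmf P) (\<lambda>\<omega>. \<omega> i)) g"
      unfolding comp by (rule integrable_measure_pmf_finite) simp
    then show ?thesis
      by (subst (asm) integrable_distr_eq) (auto simp: meas)
  qed
  have mean: "P.expectation (\<lambda>\<omega>. f (\<omega> i)) = m" for i
    unfolding E m_def ..
  have clt: "weak_conv_m (\<lambda>n. distr ?M borel (\<lambda>\<omega>. (\<Sum>i<n. f (\<omega> i) - m) / sqrt (real n * (sqrt V)\<^sup>2)))
      std_normal_distribution"
  proof (rule P.central_limit_theorem[OF ind mean])
    show "P.variance (\<lambda>\<omega>. f (\<omega> i)) = (sqrt V)\<^sup>2" for i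
      unfolding mean using E[of "\<lambda>x. (f x - m)\<^sup>2" i] \<open>V > 0\<close> by (simp add: V_def)
    show "distr ?M borel (\<lambda>\<omega>. f (\<omega> i)) = distr (measure_pmf P) borel f" for i
    proof -
      have "distr (distr ?M (measure_pmf P) (\<lambda>\<omega>. \<omega> i)) borel f = distr ?M borel (\<lambda>\<omega>. f (\<omega> i))"
        by (subst distr_distr) (auto simp: meas comp_def)
      then show ?thesis
        by (simp add: comp)
    qed
  qed (use \<open>V > 0\<close> in \<open>auto intro: int\<close>)
  from isCont_cdf_std_normal clt have lim: "(\<lambda>n. cdf (distr ?M borel (\<lambda>\<omega>. (\<Sum>i<n. f (\<omega> i) - m) / sqrt (real n * (sqrt V)\<^sup>2))) x)
      \<longlonglongrightarrow> cdf std_normal_distribution x" for x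
    by (simp add: weak_conv_m_def weak_conv_def)
  have meas_sum: "(\<lambda>\<omega>. (\<Sum>i<n. f (\<omega> i) - m) / sqrt (real n * (sqrt V)\<^sup>2)) \<in> borel_measurable ?M" for n
    using int by (intro borel_measurable_divide borel_measurable_sum borel_measurable_diff) auto
  \<comment> \<open>The normalising factor vanishes for n = 0, so the two sides are compared for
    positive n only.\<close>
  have "cdf (distr ?M borel (\<lambda>\<omega>. (\<Sum>i<n. f (\<omega> i) - m) / sqrt (real n * (sqrt V)\<^sup>2))) (r / sqrt V)
    = measure (replicate_pmf n P) {xs. (\<Sum>x\<leftarrow>xs. f x) \<le> real n * m + sqrt (real n) * r}"
    if "n > 0" for n
  proof -
    have "cdf (distr ?M borel (\<lambda>\<omega>. (\<Sum>i<n. f (\<omega> i) - m) / sqrt (real n * (sqrt V)\<^sup>2))) (r / sqrt V)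
      = measure ?M {\<omega>. (\<Sum>i<n. f (\<omega> i) - m) / sqrt (real n * (sqrt V)\<^sup>2) \<le> r / sqrt V}"
      unfolding cdf_def by (subst measure_distr[OF meas_sum]) (auto simp: space_PiM vimage_def)
    also have "{\<omega>. (\<Sum>i<n. f (\<omega> i) - m) / sqrt (real n * (sqrt V)\<^sup>2) \<le> r / sqrt V} =
       {\<omega>. map \<omega> [0..<n] \<in> {xs. (\<Sum>x\<leftarrow>xs. f x) \<le> real n * m + sqrt (real n) * r}}"
    proof -
      have "y / sqrt (real n * (sqrt V)\<^sup>2) \<le> r / sqrt V \<longleftrightarrow> y \<le> sqrt (real n) * r" for y
      proof -
        have "y / (d * c) \<le> r / c \<longleftrightarrow> y \<le> d * r" if "c > 0" "d > 0" for c d :: real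
          using that by (simp add: field_simps)
        then show ?thesis
          using \<open>V > 0\<close> that by (simp add: real_sqrt_mult)
      qed
      moreover have "(\<Sum>x\<leftarrow>map \<omega> [0..<n]. f x) = (\<Sum>i<n. f (\<omega> i) - m) + real n * m" for \<omega>
        by (simp add: sum_subtractf interv_sum_list_conv_sum_set_nat atLeast0LessThan comp_def)
      ultimately show ?thesis
        by (auto simp del: map_map)
    qed
    finally show ?thesis
      by (simp only: measure_replicate_pmf_conv_PiM)
  qed
  then show ?thesis
    by (intro Lim_transform_eventually[OF lim[of "r / sqrt V"]] eventually_sequentiallyI[of 1]) auto
qed

section \<open>The Gaussian limit, including variance zero\<close>

lemma gauss_cdf_real: "gauss_cdf (ereal x) = cdf std_normal_distribution x"
proof -
  have int: "integrable lborel std_normal_density"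
    by simp
  have "cdf std_normal_distribution x = (LINT y|lborel. std_normal_density y * indicator {..x} y)"
  proof -
    have "emeasure std_normal_distribution {..x} = (\<integral>\<^sup>+y. ennreal (std_normal_density y * indicator {..x} y) \<partial>lborel)"
      by (subst emeasure_density) (auto simp: ennreal_mult' intro!: nn_integral_cong split: split_indicator)
    also have "\<dots> = ennreal (LINT y|lborel. std_normal_density y * indicator {..x} y)"
      by (rule nn_integral_eq_integral) (auto intro!: integrable_real_mult_indicator int)
    finally show ?thesis
      by (simp add: cdf_def measure_def)
  qed
  \<comment> \<open>The interval integral in \<open>gauss_cdf\<close> ranges over an open interval,
    the distribution function over a closed half-line; the endpoint is a null set.\<close>
  also have "\<dots> = (LINT y|lborel. std_normal_density y * indicator {..<x} y)"
  proof (rule integral_cong_AE)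
    have "AE y in lborel. y \<noteq> x"
      by (rule AE_lborel_singleton)
    then show "AE y in lborel. std_normal_density y * indicator {..x} y = std_normal_density y * indicator {..<x} y"
      by eventually_elim (auto split: split_indicator)
  qed auto
  also have "\<dots> = gauss_cdf (ereal x)"
    unfolding gauss_cdf_def interval_lebesgue_integral_def set_lebesgue_integral_def
    by (simp add: std_normal_density_def einterval_def lessThan_def mult_ac)
  finally show ?thesis ..
qed

lemma gauss_cdf_infinity: "gauss_cdf \<infinity> = 1" and gauss_cdf_minus_infinity: "gauss_cdf (-\<infinity>) = 0"
proof -
  have "gauss_cdf \<infinity> = (LINT y|lborel. std_normal_density y)"
    unfolding gauss_cdf_def interval_lebesgue_integral_def set_lebesgue_integral_def
    by (simp add: std_normal_density_def)
  then show "gauss_cdf \<infinity> = 1"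
    by simp
qed (simp add: gauss_cdf_def)

text \<open>If V = 0, then f equals m on the support of P and the sum is n * m almost surely, so the
  event is certain for r > 0 and impossible for r < 0. At r = V = 0 the claim would fail: the event
  is certain, but the quotient 0 / 0 is 0 in \<open>ereal\<close>, where \<open>gauss_cdf\<close> is
  1/2.\<close>

lemma replicate_pmf_central_limit_gauss_cdf:
  fixes P :: "'a::finite pmf" and f :: "'a \<Rightarrow> real"
  defines "m \<equiv> \<Sum>x\<in>set_pmf P. pmf P x * f x"
  defines "V \<equiv> \<Sum>x\<in>set_pmf P. pmf P x * (f x - m)\<^sup>2"
  assumes "V \<noteq> 0 \<or> r \<noteq> 0"
  shows "(\<lambda>n. measure (replicate_pmf n P) {xs. (\<Sum>x\<leftarrow>xs. f x) \<le> real n * m + sqrt (real n) * r})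
    \<longlonglongrightarrow> gauss_cdf (ereal r / ereal (sqrt V))"
proof (cases "V = 0")
  case False
  moreover have "V \<ge> 0"
    by (auto simp: V_def intro!: sum_nonneg)
  ultimately have "V > 0"
    by simp
  then have "ereal r / ereal (sqrt V) = ereal (r / sqrt V)"
    by simp
  then show ?thesis
    using replicate_pmf_central_limit[of P f r] \<open>V > 0\<close> unfolding m_def V_def
    by (simp only: gauss_cdf_real)
next
  case True
  then have "r \<noteq> 0"
    using assms by simp
  have "f x = m" if "x \<in> set_pmf P" for x
  proof -
    have "pmf P x * (f x - m)\<^sup>2 = 0"
      using True that unfolding V_def by (subst (asm) sum_nonneg_eq_0_iff) auto
    then show ?thesis
      using that by (simp add: set_pmf_iff)
  qed
  then have const: "(\<Sum>x\<leftarrow>xs. f x) = real n * m" if "xs \<in> set_pmf (replicate_pmf n P)" for xs n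
  proof -
    have "map f xs = map (\<lambda>_. m) xs"
      using that \<open>\<And>x. x \<in> set_pmf P \<Longrightarrow> f x = m\<close> by (auto simp: set_replicate_pmf in_lists_conv_set)
    then have "(\<Sum>x\<leftarrow>xs. f x) = real (length xs) * m"
      by (simp only: sum_list_triv)
    then show ?thesis
      using that by (simp add: set_replicate_pmf)
  qed
  have "measure (replicate_pmf n P) {xs. (\<Sum>x\<leftarrow>xs. f x) \<le> real n * m + sqrt (real n) * r}
      = gauss_cdf (ereal r / ereal (sqrt V))" if "n > 0" for n
  proof -
    have sgn: "0 \<le> sqrt (real n) * r \<longleftrightarrow> r > 0"
      using that \<open>r \<noteq> 0\<close> by (auto simp: zero_le_mult_iff)
    have "measure (replicate_pmf n P) {xs. (\<Sum>x\<leftarrow>xs. f x) \<le> real n * m + sqrt (real n) * r}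
      = measure (replicate_pmf n P) (if r > 0 then UNIV else {})"
      by (rule measure_eq_AE) (auto simp: AE_measure_pmf_iff const sgn)
    also have "\<dots> = gauss_cdf (ereal r / ereal (sqrt V))"
      using \<open>r \<noteq> 0\<close> True
      by (cases "r > 0") (auto simp: gauss_cdf_infinity gauss_cdf_minus_infinity divide_ereal_def)
    finally show ?thesis .
  qed
  then show ?thesis
    by (intro tendsto_eventually eventually_sequentiallyI[of 1]) auto
qed

text \<open>For V = 0 the function is constant on each side of 0, hence locally constant at every r
  different from 0.\<close>

lemma isCont_gauss_cdf_div:
  fixes r V :: real
  assumes "V \<ge> 0" "V \<noteq> 0 \<or> r \<noteq> 0"
  shows "isCont (\<lambda>r. gauss_cdf (ereal r / ereal (sqrt V))) r"
proof (cases "V = 0")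
  case False
  have "isCont (\<lambda>r. cdf std_normal_distribution (r / sqrt V)) r"
    using False by (intro isCont_o2[OF _ isCont_cdf_std_normal, of r "\<lambda>r. r / sqrt V"]) simp
  then show ?thesis
    using False assms(1) by (simp add: gauss_cdf_real)
next
  case True
  then have "r \<noteq> 0"
    using assms by simp
  have "\<forall>\<^sub>F x in nhds r. (x > 0) = (r > 0) \<and> x \<noteq> 0"
  proof (cases "r > 0")
    case True
    have "\<forall>\<^sub>F x in nhds r. x \<in> {0<..}"
      by (rule eventually_nhds_in_open) (use True in auto)
    then show ?thesis
      by eventually_elim (use True in auto)
  next
    case False
    have "\<forall>\<^sub>F x in nhds r. x \<in> {..<0}"
      by (rule eventually_nhds_in_open) (use False \<open>r \<noteq> 0\<close> in auto)
    then show ?thesis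
      by eventually_elim (use False in auto)
  qed
  then have "\<forall>\<^sub>F x in nhds r. gauss_cdf (ereal x / ereal (sqrt V)) = (if r > 0 then 1 else 0)"
    by eventually_elim
      (auto simp: True gauss_cdf_infinity gauss_cdf_minus_infinity divide_ereal_def)
  then show ?thesis
    by (subst isCont_cong) auto
qed

section \<open>Words, permutation invariance and symmetrization\<close>

lemma finite_set_pmf_dists:
  fixes p :: "'a::finite list pmf"
  shows "p \<in> dists n \<Longrightarrow> finite (set_pmf p)"
  using finite_subset[OF _ finite_words] by (auto simp: dists_def)

lemma sum_pmf_words:
  fixes p :: "'a::finite list pmf"
  assumes "p \<in> dists n"
  shows "sum (pmf p) (words n) = 1"
  using assms by (intro sum_pmf_eq_1) (auto simp: finite_words dists_def)

lemma measure_pmf_eq_sum_words: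
  fixes p :: "'a::finite list pmf"
  assumes "p \<in> dists n"
  shows "measure p A = (\<Sum>xs\<in>A \<inter> words n. pmf p xs)"
proof -
  have "A \<inter> set_pmf p = (A \<inter> words n) \<inter> set_pmf p"
    using assms by (auto simp: dists_def)
  then have "measure p A = measure p (A \<inter> words n)"
    by (metis measure_Int_set_pmf)
  then show ?thesis
    by (simp add: measure_measure_pmf_finite finite_words)
qed

lemma expectation_pmf_words:
  fixes p :: "'a::finite list pmf" and g :: "'a list \<Rightarrow> real"
  assumes "p \<in> dists n"
  shows "measure_pmf.expectation p g = (\<Sum>xs\<in>set_pmf p. pmf p xs * g xs)"
  by (subst integral_measure_pmf_real[OF finite_set_pmf_dists[OF assms]])
    (auto simp: set_pmf_iff mult.commute)

lemma replicate_pmf_in_dists: "replicate_pmf n P \<in> dists n"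
  by (auto simp: dists_def words_def set_replicate_pmf)

lemma perm_act_in_dists: "p \<in> dists n \<Longrightarrow> perm_act \<pi> p \<in> dists n"
  by (auto simp: dists_def words_def perm_act_def)

lemma pmf_eq_0_dists: "p \<in> dists n \<Longrightarrow> xs \<notin> words n \<Longrightarrow> pmf p xs = 0"
  by (auto simp: dists_def set_pmf_iff)

lemma pmf_sym_dists_permute_list:
  assumes "p \<in> sym_dists n" "\<pi> permutes {..<n}" "xs \<in> words n"
  shows "pmf p (permute_list \<pi> xs) = pmf p xs"
  using assms pmf_perm_act[of p n \<pi> xs] by (simp add: sym_dists_def words_def)

lemma replicate_pmf_in_sym_dists: "replicate_pmf n P \<in> sym_dists n"
proof -
  have "perm_act \<pi> (replicate_pmf n P) = replicate_pmf n P" if \<pi>: "\<pi> permutes {..<n}" for \<pi>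
  proof (rule pmf_eqI)
    fix xs :: "'a list"
    show "pmf (perm_act \<pi> (replicate_pmf n P)) xs = pmf (replicate_pmf n P) xs"
    proof (cases "length xs = n")
      case True
      have "pmf (perm_act \<pi> (replicate_pmf n P)) xs = pmf (replicate_pmf n P) (permute_list \<pi> xs)"
        by (rule pmf_perm_act[OF replicate_pmf_in_dists \<pi> True])
      \<comment> \<open>The product depends only on the multiset of letters, which a permutation
        preserves.\<close>
      also have "\<dots> = (\<Prod>x\<in>#mset (permute_list \<pi> xs). pmf P x)"
        using pmf_replicate_pmf[of "permute_list \<pi> xs" P] True
        by (simp flip: prod_mset_prod_list)
      also have "\<dots> = (\<Prod>x\<in>#mset xs. pmf P x)"
        using \<pi> True by simp
      also have "\<dots> = pmf (replicate_pmf n P) xs"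
        using pmf_replicate_pmf[of xs P] True by (simp flip: prod_mset_prod_list)
      finally show ?thesis .
    next
      case False
      then show ?thesis
        using pmf_eq_0_dists perm_act_in_dists replicate_pmf_in_dists
        by (metis (mono_tags, lifting) mem_Collect_eq words_def)
    qed
  qed
  then show ?thesis
    by (simp add: sym_dists_def replicate_pmf_in_dists)
qed

text \<open>Reindexing the words moves the permutation from q to the test, which does not notice it;
  the average thus consists of n! equal terms. An invariant test can therefore be judged against
  symmetric alternatives, the only ones that the universal distribution dominates.\<close>

lemma sum_symmetrize:
  fixes q :: "'a::finite list pmf"
  assumes q: "q \<in> dists n"
    and T: "\<And>\<pi> xs. \<pi> permutes {..<n} \<Longrightarrow> xs \<in> words n \<Longrightarrow> T (permute_list \<pi> xs) = T xs"
  shows "(\<Sum>xs\<in>words n. pmf (symmetrize n q) xs * T xs) = (\<Sum>xs\<in>words n. pmf q xs * T xs)"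
proof -
  have perm: "(\<Sum>xs\<in>words n. pmf (perm_act \<pi> q) xs * T xs) = (\<Sum>xs\<in>words n. pmf q xs * T xs)"
    if \<pi>: "\<pi> permutes {..<n}" for \<pi>
  proof -
    have inj: "inj_on (permute_list \<pi>) (words n :: 'a list set)"
    proof (rule inj_on_inverseI)
      fix ys :: "'a list" assume "ys \<in> words n"
      then have "permute_list (\<pi> \<circ> inv \<pi>) ys = permute_list (inv \<pi>) (permute_list \<pi> ys)"
        using permutes_inv[OF \<pi>] by (intro permute_list_compose) (simp add: words_def)
      then show "permute_list (inv \<pi>) (permute_list \<pi> ys) = ys"
        by (simp only: permutes_inv_o(1)[OF \<pi>] permute_list_id)
    qed
    have bij: "bij_betw (permute_list \<pi>) (words n :: 'a list set) (words n)"
      unfolding bij_betw_def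
      by (intro conjI inj endo_inj_surj[OF finite_words _ inj]) (auto simp: words_def)
    have "(\<Sum>xs\<in>words n. pmf (perm_act \<pi> q) xs * T xs) =
        (\<Sum>xs\<in>words n. pmf q (permute_list \<pi> xs) * T (permute_list \<pi> xs))"
      using pmf_perm_act[OF q \<pi>] T[OF \<pi>] by (intro sum.cong) (auto simp: words_def)
    also have "\<dots> = (\<Sum>xs\<in>words n. pmf q xs * T xs)"
      by (rule sum.reindex_bij_betw[OF bij])
    finally show ?thesis .
  qed
  have card: "card {\<pi>. \<pi> permutes {..<n}} = fact n"
    by (rule card_permutations) auto
  have "(\<Sum>xs\<in>words n. pmf (symmetrize n q) xs * T xs) =
      (1 / fact n) * (\<Sum>xs\<in>words n. \<Sum>\<pi> | \<pi> permutes {..<n}. pmf (perm_act \<pi> q) xs * T xs)"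
    by (simp add: pmf_symmetrize sum_distrib_left sum_distrib_right mult.assoc)
  also have "\<dots> = (1 / fact n) * (\<Sum>\<pi> | \<pi> permutes {..<n}. \<Sum>xs\<in>words n. pmf (perm_act \<pi> q) xs * T xs)"
    by (subst sum.swap) simp
  also have "\<dots> = (\<Sum>xs\<in>words n. pmf q xs * T xs)"
    by (simp add: perm card)
  finally show ?thesis .
qed

section \<open>Bounds on the optimal error of the first kind\<close>

lemma bdd_above_type2_error:
  fixes T :: "'a::finite list \<Rightarrow> real"
  assumes "T \<in> tests n"
  shows "bdd_above ((\<lambda>q. \<Sum>xs\<in>words n. pmf q xs * T xs) ` S)"
proof (rule bdd_aboveI2)
  fix q :: "'a list pmf"
  have "(\<Sum>xs\<in>words n. pmf q xs * T xs) \<le> (\<Sum>xs\<in>words n. pmf q xs)"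
    using assms by (intro sum_mono mult_left_le) (auto simp: tests_def)
  also have "\<dots> \<le> 1"
    by (simp add: finite_words flip: measure_measure_pmf_finite)
  finally show "(\<Sum>xs\<in>words n. pmf q xs * T xs) \<le> 1" .
qed

lemma type1_error_nonneg: "T \<in> tests n \<Longrightarrow> 0 \<le> type1_error n T p"
  unfolding type1_error_def tests_def by (auto intro!: sum_nonneg)

text \<open>Where p <= c * q, a test of level \<open>\<mu>\<close> can accept p-mass at most c times
  the q-mass that it accepts, hence at most \<open>c * \<mu>\<close>. The rest of this set counts as
  error.\<close>

lemma opt_type1_error_ge:
  fixes p :: "'a::finite list pmf"
  assumes p: "p \<in> dists n" and q: "q \<in> S" and "\<mu> \<ge> 0" "c \<ge> 0"
  shows "opt_type1_error n \<mu> p S \<ge> measure p {xs. pmf p xs \<le> c * pmf q xs} - c * \<mu>"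
proof -
  obtain T where T: "T \<in> tests n" "type2_error n T S \<le> \<mu>"
      and opt: "type1_error n T p = opt_type1_error n \<mu> p S"
    using opt_type1_error_attained[of S \<mu> n p] q \<open>\<mu> \<ge> 0\<close> by blast
  have T01: "0 \<le> T xs" "T xs \<le> 1" if "xs \<in> words n" for xs
    using T(1) that by (auto simp: tests_def)
  define A where "A = {xs. pmf p xs \<le> c * pmf q xs} \<inter> words n"
  have A: "finite A" "A \<subseteq> words n"
    unfolding A_def using finite_words by auto
  have "(\<Sum>xs\<in>A. pmf p xs * T xs) \<le> (\<Sum>xs\<in>A. c * (pmf q xs * T xs))"
  proof (rule sum_mono)
    fix xs assume "xs \<in> A"
    then have "pmf p xs * T xs \<le> (c * pmf q xs) * T xs"
      by (intro mult_right_mono) (auto simp: A_def T01)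
    then show "pmf p xs * T xs \<le> c * (pmf q xs * T xs)"
      by (simp add: mult.assoc)
  qed
  also have "\<dots> \<le> (\<Sum>xs\<in>words n. c * (pmf q xs * T xs))"
    using A \<open>c \<ge> 0\<close> by (intro sum_mono2 finite_words) (auto simp: T01)
  also have "\<dots> = c * (\<Sum>xs\<in>words n. pmf q xs * T xs)"
    by (simp add: sum_distrib_left)
  also have "\<dots> \<le> c * type2_error n T S"
    unfolding type2_error_def using \<open>c \<ge> 0\<close>
    by (intro mult_left_mono cSUP_upper q bdd_above_type2_error T(1))
  also have "\<dots> \<le> c * \<mu>"
    using T(2) \<open>c \<ge> 0\<close> by (rule mult_left_mono)
  finally have "measure p {xs. pmf p xs \<le> c * pmf q xs} - c * \<mu> \<le> (\<Sum>xs\<in>A. pmf p xs * (1 - T xs))"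
    unfolding measure_pmf_eq_sum_words[OF p] A_def[symmetric]
    by (simp add: right_diff_distrib sum_subtractf)
  also have "\<dots> \<le> type1_error n T p"
    unfolding type1_error_def using A by (intro sum_mono2 finite_words) (auto simp: T01)
  finally show ?thesis
    using opt by simp
qed

text \<open>The competitor is the likelihood ratio test of p against u. It is permutation invariant
  because p and u are, so \<open>sum_symmetrize\<close> reduces its second error to symmetric
  alternatives.\<close>

lemma opt_type1_error_le:
  fixes p :: "'a::finite list pmf"
  assumes p: "p \<in> sym_dists n" and u: "u \<in> sym_dists n"
    and S: "S \<noteq> {}" "S \<subseteq> dists n" "\<And>q. q \<in> S \<Longrightarrow> symmetrize n q \<in> S \<inter> sym_dists n"
    and le: "\<And>q xs. q \<in> S \<inter> sym_dists n \<Longrightarrow> xs \<in> words n \<Longrightarrow> pmf q xs \<le> v * pmf u xs"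
    and "v > 0" "\<mu> > 0"
  shows "opt_type1_error n \<mu> p S \<le> measure p {xs. pmf p xs < v / \<mu> * pmf u xs}"
proof -
  \<comment> \<open>The threshold makes \<open>v * pmf u xs <= \<mu> * pmf p xs\<close> wherever the
    test accepts. Symmetric alternatives lie below the left side, and the right side sums to
    \<open>\<mu>\<close>.\<close>
  define T :: "'a list \<Rightarrow> real" where "T xs = of_bool (v / \<mu> * pmf u xs \<le> pmf p xs)" for xs
  have T: "T \<in> tests n"
    by (auto simp: tests_def T_def)
  have pd: "p \<in> dists n"
    using p by (simp add: sym_dists_def)
  have "(\<Sum>xs\<in>words n. pmf q xs * T xs) \<le> \<mu>" if q: "q \<in> S" for q
  proof -
    have "(\<Sum>xs\<in>words n. pmf q xs * T xs) = (\<Sum>xs\<in>words n. pmf (symmetrize n q) xs * T xs)"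
      using q S(2) pmf_sym_dists_permute_list[OF p] pmf_sym_dists_permute_list[OF u]
      by (intro sum_symmetrize[symmetric]) (auto simp: T_def)
    also have "\<dots> \<le> (\<Sum>xs\<in>words n. \<mu> * pmf p xs)"
    proof (rule sum_mono)
      fix xs :: "'a list" assume xs: "xs \<in> words n"
      have "pmf (symmetrize n q) xs \<le> v * pmf u xs"
        by (rule le[OF S(3)[OF q] xs])
      then show "pmf (symmetrize n q) xs * T xs \<le> \<mu> * pmf p xs"
        using \<open>\<mu> > 0\<close> by (auto simp: T_def field_simps)
    qed
    also have "\<dots> = \<mu>"
      using sum_pmf_words[OF pd] by (simp flip: sum_distrib_left)
    finally show ?thesis .
  qed
  then have "type2_error n T S \<le> \<mu>"
    unfolding type2_error_def by (intro cSUP_least S)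
  then have "opt_type1_error n \<mu> p S \<le> type1_error n T p"
    unfolding opt_type1_error_def
    by (intro cINF_lower bdd_belowI2[of _ 0]) (auto simp: T type1_error_nonneg)
  also have "\<dots> = (\<Sum>xs\<in>words n. if xs \<in> {xs. pmf p xs < v / \<mu> * pmf u xs} then pmf p xs else 0)"
    unfolding type1_error_def by (intro sum.cong) (auto simp: T_def)
  also have "\<dots> = measure p {xs. pmf p xs < v / \<mu> * pmf u xs}"
    unfolding measure_pmf_eq_sum_words[OF pd]
    by (subst sum.inter_restrict[OF finite_words, symmetric]) (simp add: Int_commute)
  finally show ?thesis .
qed

section \<open>Relative entropy and asymptotic estimates\<close>

lemma renyi_div_1_eq:
  assumes "\<And>x. x \<in> set_pmf P \<Longrightarrow> pmf Q x > 0"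
  shows "renyi_div b 1 P Q = ereal (\<Sum>x\<in>set_pmf P. pmf P x * (log b (pmf P x) - log b (pmf Q x)))"
proof -
  have "renyi_div b 1 P Q = (\<Sum>x\<in>set_pmf P. ereal (pmf P x * (log b (pmf P x) - log b (pmf Q x))))"
    unfolding renyi_div_def if_P[OF refl]
  proof (rule sum.cong[OF refl])
    fix x assume "x \<in> set_pmf P"
    with assms[of x] show "ereal (pmf P x) * (elog b (ereal (pmf P x)) - elog b (ereal (pmf Q x))) =
        ereal (pmf P x * (log b (pmf P x) - log b (pmf Q x)))"
      by (simp add: elog_def set_pmf_iff)
  qed
  then show ?thesis
    by simp
qed

text \<open>A zero of Q on the support of P contributes an infinite summand, which makes the whole
  sum infinite.\<close>

lemma pmf_pos_if_renyi_div_1_finite: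
  assumes "finite (set_pmf P)" "renyi_div b 1 P Q \<noteq> \<infinity>" "x \<in> set_pmf P"
  shows "pmf Q x > 0"
proof (rule ccontr)
  assume "\<not> pmf Q x > 0"
  then have "ereal (pmf P x) * (elog b (ereal (pmf P x)) - elog b (ereal (pmf Q x))) = \<infinity>"
    using assms(3) by (simp add: elog_def pmf_positive_iff set_pmf_iff not_less)
  then have "renyi_div b 1 P Q = \<infinity>"
    unfolding renyi_div_def using assms by (auto simp: sum_Pinfty)
  with assms(2) show False
    by simp
qed

text \<open>A bound by a single monomial has a logarithm that is affine in ln x.\<close>

lemma poly_le_power:
  fixes p :: "real poly" and x :: real
  assumes "x \<ge> 1"
  shows "poly p x \<le> (\<Sum>i\<le>degree p. \<bar>coeff p i\<bar>) * x ^ degree p"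
proof -
  have "poly p x = (\<Sum>i\<le>degree p. coeff p i * x ^ i)"
    by (rule poly_altdef)
  also have "\<dots> \<le> (\<Sum>i\<le>degree p. \<bar>coeff p i\<bar> * x ^ degree p)"
    using assms by (intro sum_mono mult_mono power_increasing) auto
  finally show ?thesis
    by (simp add: sum_distrib_right)
qed

lemma log_poly_over_sqrt_tendsto_0:
  fixes v :: "real poly"
  assumes "b > 1" "\<epsilon> > 0" "\<And>n. n \<ge> 1 \<Longrightarrow> poly v (real n) \<ge> 1"
  shows "(\<lambda>n. log b (poly v (real n)) / (sqrt (real n) * \<epsilon>)) \<longlonglongrightarrow> 0"
proof -
  define C where "C = (\<Sum>i\<le>degree v. \<bar>coeff v i\<bar>)"
  define k where "k = degree v"
  have le: "poly v (real n) \<le> C * real n ^ k" if "n \<ge> 1" for n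
    using poly_le_power[of "real n" v] that by (simp add: C_def k_def)
  \<comment> \<open>Comparing the bound with the hypothesis at n = 1 makes C positive, so that the
    logarithm of the product can be split.\<close>
  have "C \<ge> 1"
    using le[of 1] assms(3)[of 1] by simp
  have lim: "(\<lambda>n. (ln C + real k * ln (real n)) / ln b / (sqrt (real n) * \<epsilon>)) \<longlonglongrightarrow> 0"
    using \<open>\<epsilon> > 0\<close> \<open>b > 1\<close> by real_asymp
  have upper: "\<forall>\<^sub>F n in sequentially. log b (poly v (real n)) / (sqrt (real n) * \<epsilon>)
      \<le> (ln C + real k * ln (real n)) / ln b / (sqrt (real n) * \<epsilon>)"
  proof (rule eventually_sequentiallyI[of 1])
    fix n :: nat assume n: "n \<ge> 1"
    have "ln (poly v (real n)) \<le> ln (C * real n ^ k)"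
      using le[OF n] assms(3)[OF n] by simp
    also have "\<dots> = ln C + real k * ln (real n)"
      using \<open>C \<ge> 1\<close> n by (simp add: ln_mult ln_realpow)
    finally show "log b (poly v (real n)) / (sqrt (real n) * \<epsilon>)
      \<le> (ln C + real k * ln (real n)) / ln b / (sqrt (real n) * \<epsilon>)"
      unfolding log_def using \<open>\<epsilon> > 0\<close> \<open>b > 1\<close> by (intro divide_right_mono) auto
  qed
  have lower: "\<forall>\<^sub>F n in sequentially. 0 \<le> log b (poly v (real n)) / (sqrt (real n) * \<epsilon>)"
    using assms(1,2) assms(3)[THEN order_trans[OF zero_le_one]] assms(3)
    by (intro eventually_sequentiallyI[of 1] divide_nonneg_nonneg)
      (auto simp: zero_le_log_cancel_iff less_le_trans[OF zero_less_one])
  show ?thesis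
    by (rule tendsto_sandwich[OF lower upper tendsto_const lim])
qed

text \<open>For fixed \<open>\<epsilon>\<close> the error terms disappear and \<open>a\<close> is
  eventually trapped near \<open>G (r - \<epsilon>)\<close> and \<open>G (r + \<epsilon>)\<close>,
  which continuity puts close to \<open>G r\<close>. Convergence is asked for only within
  \<open>\<rho>\<close> of r, so that a jump of the limit farther away does no harm.\<close>

lemma shifted_sandwich_tendsto:
  fixes a :: "nat \<Rightarrow> real" and F :: "nat \<Rightarrow> real \<Rightarrow> real" and r :: real
  assumes cont: "isCont G r"
    and F: "\<And>x. x \<noteq> r \<Longrightarrow> dist x r < \<rho> \<Longrightarrow> (\<lambda>n. F n x) \<longlonglongrightarrow> G x" and "\<rho> > 0"
    and lower: "\<And>\<epsilon>. \<epsilon> > 0 \<Longrightarrow> \<forall>\<^sub>F n in sequentially. F n (r - \<epsilon>) - l \<epsilon> n \<le> a n"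
    and upper: "\<And>\<epsilon>. \<epsilon> > 0 \<Longrightarrow> \<forall>\<^sub>F n in sequentially. a n \<le> F n (r + \<epsilon>) + u \<epsilon> n"
    and l: "\<And>\<epsilon>. \<epsilon> > 0 \<Longrightarrow> l \<epsilon> \<longlonglongrightarrow> 0" and u: "\<And>\<epsilon>. \<epsilon> > 0 \<Longrightarrow> u \<epsilon> \<longlonglongrightarrow> 0"
  shows "a \<longlonglongrightarrow> G r"
proof (rule tendstoI)
  fix \<delta> :: real assume "\<delta> > 0"
  then obtain e where e: "e > 0" "\<And>x. dist x r < e \<Longrightarrow> dist (G x) (G r) < \<delta>"
    using cont by (auto simp: continuous_at_eps_delta)
  define \<epsilon> where "\<epsilon> = min e \<rho> / 2"
  have \<epsilon>: "\<epsilon> > 0" "\<epsilon> < e" "\<epsilon> < \<rho>"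
    using e \<open>\<rho> > 0\<close> by (auto simp: \<epsilon>_def)
  have "(\<lambda>n. F n (r - \<epsilon>) - l \<epsilon> n) \<longlonglongrightarrow> G (r - \<epsilon>) - 0"
    using \<epsilon> by (intro tendsto_diff F l) (auto simp: dist_real_def)
  moreover have "G (r - \<epsilon>) - 0 > G r - \<delta>"
    using e(2)[of "r - \<epsilon>"] \<epsilon> by (auto simp: dist_real_def)
  ultimately have low: "\<forall>\<^sub>F n in sequentially. F n (r - \<epsilon>) - l \<epsilon> n > G r - \<delta>"
    by (rule order_tendstoD)
  have "(\<lambda>n. F n (r + \<epsilon>) + u \<epsilon> n) \<longlonglongrightarrow> G (r + \<epsilon>) + 0"
    using \<epsilon> by (intro tendsto_add F u) (auto simp: dist_real_def)
  moreover have "G (r + \<epsilon>) + 0 < G r + \<delta>"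
    using e(2)[of "r + \<epsilon>"] \<epsilon> by (auto simp: dist_real_def)
  ultimately have up: "\<forall>\<^sub>F n in sequentially. F n (r + \<epsilon>) + u \<epsilon> n < G r + \<delta>"
    by (rule order_tendstoD)
  show "\<forall>\<^sub>F n in sequentially. dist (a n) (G r) < \<delta>"
    using low up lower[OF \<epsilon>(1)] upper[OF \<epsilon>(1)]
    by eventually_elim (auto simp: dist_real_def)
qed

section \<open>Log-likelihood ratios of product distributions\<close>

lemma log_pmf_replicate_pmf:
  assumes "xs \<in> set_pmf (replicate_pmf n P)" "\<And>x. x \<in> set_pmf P \<Longrightarrow> pmf Q x > 0" "b > 1"
  shows "pmf (replicate_pmf n Q) xs > 0"
    and "log b (pmf (replicate_pmf n Q) xs) = (\<Sum>x\<leftarrow>xs. log b (pmf Q x))"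
proof -
  have len: "length xs = n" and pos: "\<forall>x\<in>set xs. pmf Q x > 0"
    using assms(1,2) by (auto simp: set_replicate_pmf)
  have "(\<Prod>x\<leftarrow>xs. pmf Q x) > 0 \<and> log b (\<Prod>x\<leftarrow>xs. pmf Q x) = (\<Sum>x\<leftarrow>xs. log b (pmf Q x))"
    using pos
  proof (induction xs)
    case (Cons x xs)
    then have *: "(\<Prod>x\<leftarrow>xs. pmf Q x) > 0" "pmf Q x > 0"
        "log b (\<Prod>x\<leftarrow>xs. pmf Q x) = (\<Sum>x\<leftarrow>xs. log b (pmf Q x))"
      by auto
    then show ?case
      using log_mult[of b "pmf Q x" "\<Prod>x\<leftarrow>xs. pmf Q x"] by (simp del: pmf_positive_iff)
  qed simp
  then show "pmf (replicate_pmf n Q) xs > 0"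
    and "log b (pmf (replicate_pmf n Q) xs) = (\<Sum>x\<leftarrow>xs. log b (pmf Q x))"
    using pmf_replicate_pmf[of xs Q] len by auto
qed

lemma expectation_replicate_pmf_sum_list:
  fixes P :: "'a::finite pmf" and f :: "'a \<Rightarrow> real"
  shows "measure_pmf.expectation (replicate_pmf n P) (\<lambda>xs. \<Sum>x\<leftarrow>xs. f x) =
    real n * (\<Sum>x\<in>set_pmf P. pmf P x * f x)"
proof (induction n)
  case (Suc n)
  let ?R = "replicate_pmf n P"
  have fin: "finite (set_pmf (pair_pmf P ?R))"
    using finite_set_pmf_dists[OF replicate_pmf_in_dists, of n P] by simp
  have eq: "replicate_pmf (Suc n) P = map_pmf (\<lambda>(x, xs). x # xs) (pair_pmf P ?R)"
    by (simp add: pair_pmf_def map_bind_pmf)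
  have "measure_pmf.expectation (replicate_pmf (Suc n) P) (\<lambda>xs. \<Sum>x\<leftarrow>xs. f x) =
      measure_pmf.expectation (pair_pmf P ?R) (\<lambda>z. f (fst z) + (\<Sum>x\<leftarrow>snd z. f x))"
    unfolding eq by (simp add: case_prod_beta)
  also have "\<dots> = measure_pmf.expectation (pair_pmf P ?R) (\<lambda>z. f (fst z)) +
      measure_pmf.expectation (pair_pmf P ?R) (\<lambda>z. \<Sum>x\<leftarrow>snd z. f x)"
    by (intro Bochner_Integration.integral_add integrable_measure_pmf_finite fin)
  also have "measure_pmf.expectation (pair_pmf P ?R) (\<lambda>z. f (fst z)) =
      measure_pmf.expectation (map_pmf fst (pair_pmf P ?R)) f"
    by simp
  also have "\<dots> = (\<Sum>x\<in>set_pmf P. pmf P x * f x)"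
    unfolding map_fst_pair_pmf
    by (subst integral_measure_pmf_real[of "set_pmf P"]) (auto simp: set_pmf_iff mult.commute)
  also have "measure_pmf.expectation (pair_pmf P ?R) (\<lambda>z. \<Sum>x\<leftarrow>snd z. f x) =
      measure_pmf.expectation (map_pmf snd (pair_pmf P ?R)) (\<lambda>xs. \<Sum>x\<leftarrow>xs. f x)"
    by simp
  also have "\<dots> = real n * (\<Sum>x\<in>set_pmf P. pmf P x * f x)"
    unfolding map_snd_pair_pmf by (rule Suc.IH)
  finally show ?case
    by (simp add: algebra_simps)
qed simp

lemma sum_list_log_ratio:
  assumes "xs \<in> set_pmf (replicate_pmf n P)" "\<And>x. x \<in> set_pmf P \<Longrightarrow> pmf Q x > 0" "b > 1"
  shows "(\<Sum>x\<leftarrow>xs. log b (pmf P x) - log b (pmf Q x)) =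
    log b (pmf (replicate_pmf n P) xs) - log b (pmf (replicate_pmf n Q) xs)"
  using log_pmf_replicate_pmf(2)[OF assms] log_pmf_replicate_pmf(2)[OF assms(1) _ assms(3), of P]
  by (simp add: sum_list_subtractf pmf_positive_iff)

text \<open>Taking c = b^(a - d) in \<open>opt_type1_error_ge\<close> turns its loss into b^(a - d)
  * b^(-a) = b^(-d). Here d is the distance by which the threshold stays below a.\<close>

lemma opt_type1_error_product_ge:
  fixes P Q :: "'a::finite pmf"
  assumes "b > 1" and pos: "\<And>x. x \<in> set_pmf P \<Longrightarrow> pmf Q x > 0"
    and "replicate_pmf n Q \<in> S"
  shows "opt_type1_error n (b powr (- a)) (replicate_pmf n P) S \<ge>
    measure (replicate_pmf n P) {xs. (\<Sum>x\<leftarrow>xs. log b (pmf P x) - log b (pmf Q x)) \<le> a - d} - b powr (- d)"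
proof -
  let ?p = "replicate_pmf n P" and ?q = "replicate_pmf n Q"
  have "pmf ?p xs \<le> b powr (a - d) * pmf ?q xs"
    if xs: "xs \<in> set_pmf ?p" and le: "(\<Sum>x\<leftarrow>xs. log b (pmf P x) - log b (pmf Q x)) \<le> a - d" for xs
  proof -
    note q = log_pmf_replicate_pmf(1)[OF xs pos \<open>b > 1\<close>, simplified]
    have "pmf ?p xs = b powr log b (pmf ?p xs)"
      using xs \<open>b > 1\<close> by (simp add: pmf_positive_iff)
    also have "\<dots> \<le> b powr (a - d + log b (pmf ?q xs))"
      using le \<open>b > 1\<close> sum_list_log_ratio[OF xs pos \<open>b > 1\<close>] by (intro powr_mono) auto
    also have "\<dots> = b powr (a - d) * pmf ?q xs"
      using q \<open>b > 1\<close> by (simp add: powr_add pmf_positive_iff)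
    finally show ?thesis .
  qed
  then have "measure ?p {xs. (\<Sum>x\<leftarrow>xs. log b (pmf P x) - log b (pmf Q x)) \<le> a - d} \<le>
      measure ?p {xs. pmf ?p xs \<le> b powr (a - d) * pmf ?q xs}"
    by (intro measure_pmf.finite_measure_mono_AE) (auto simp: AE_measure_pmf_iff)
  moreover have "b powr (a - d) * b powr (- a) = b powr (- d)"
    by (simp flip: powr_add)
  ultimately show ?thesis
    using opt_type1_error_ge[OF replicate_pmf_in_dists[of n P] assms(3), of "b powr (- a)" "b powr (a - d)"]
    by simp
qed

text \<open>The factor v in the threshold raises the cut for \<open>LU\<close> to a + log v. The
  same log v occurs in the nonnegative variable \<open>Z\<close>, so the two cancel and the only
  shift left in the event for the product distributions is d.\<close>

lemma measure_universal_threshold_le: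
  fixes P Q :: "'a::finite pmf"
  assumes "b > 1" and pos: "\<And>x. x \<in> set_pmf P \<Longrightarrow> pmf Q x > 0"
    and dom: "\<And>xs. xs \<in> words n \<Longrightarrow> pmf (replicate_pmf n Q) xs \<le> v * pmf u xs"
    and div: "renyi_div b 1 (replicate_pmf n P) u
      \<ge> ereal (real n * (\<Sum>x\<in>set_pmf P. pmf P x * (log b (pmf P x) - log b (pmf Q x))))"
    and "v > 0" "d > 0"
  shows "measure (replicate_pmf n P) {xs. pmf (replicate_pmf n P) xs < v / (b powr (- a)) * pmf u xs} \<le>
    measure (replicate_pmf n P) {xs. (\<Sum>x\<leftarrow>xs. log b (pmf P x) - log b (pmf Q x)) \<le> a + d} + log b v / d"
proof -
  let ?p = "replicate_pmf n P" and ?q = "replicate_pmf n Q"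
  let ?L = "\<lambda>xs. \<Sum>x\<leftarrow>xs. log b (pmf P x) - log b (pmf Q x)"
  define LU where "LU xs = log b (pmf ?p xs) - log b (pmf u xs)" for xs
  define Z where "Z xs = ?L xs + log b v - LU xs" for xs
  have p0: "pmf ?p xs > 0" and q0: "pmf ?q xs > 0" if "xs \<in> set_pmf ?p" for xs
    using that log_pmf_replicate_pmf(1)[OF that pos \<open>b > 1\<close>] by (auto simp: pmf_positive_iff)
  \<comment> \<open>Domination carries positivity from the product of Q over to u; without it the
    logarithms in \<open>LU\<close> would not represent the divergence.\<close>
  have u0: "pmf u xs > 0" and Z0: "Z xs \<ge> 0" if xs: "xs \<in> set_pmf ?p" for xs
  proof -
    have le: "pmf ?q xs \<le> v * pmf u xs"
      using xs by (intro dom) (auto simp: set_replicate_pmf words_def)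
    then have "v * pmf u xs > 0"
      using q0[OF xs] by linarith
    then show u: "pmf u xs > 0"
      using \<open>v > 0\<close> by (simp add: zero_less_mult_iff del: pmf_positive_iff)
    have "log b (pmf ?q xs) \<le> log b (v * pmf u xs)"
      using le q0[OF xs] \<open>b > 1\<close> by (intro log_mono)
    also have "\<dots> = log b v + log b (pmf u xs)"
      using u \<open>v > 0\<close> by (subst log_mult) (auto simp del: pmf_positive_iff)
    finally show "Z xs \<ge> 0"
      by (simp add: Z_def LU_def sum_list_log_ratio[OF xs pos \<open>b > 1\<close>])
  qed
  have int: "integrable ?p g" for g :: "'a list \<Rightarrow> real"
    by (intro integrable_measure_pmf_finite finite_set_pmf_dists[OF replicate_pmf_in_dists])
  have "measure_pmf.expectation ?p LU = real_of_ereal (renyi_div b 1 ?p u)"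
    by (subst renyi_div_1_eq[OF u0]) (simp_all add: expectation_pmf_words[OF replicate_pmf_in_dists] LU_def)
  then have "measure_pmf.expectation ?p LU \<ge>
      real n * (\<Sum>x\<in>set_pmf P. pmf P x * (log b (pmf P x) - log b (pmf Q x)))"
    using div renyi_div_1_eq[of ?p u b, OF u0] by simp
  then have EZ: "measure_pmf.expectation ?p Z \<le> log b v"
    unfolding Z_def
    by (simp add: Bochner_Integration.integral_add Bochner_Integration.integral_diff int
        expectation_replicate_pmf_sum_list)
  have "measure ?p {xs. pmf ?p xs < v / (b powr (- a)) * pmf u xs} \<le>
      measure ?p ({xs. ?L xs \<le> a + d} \<union> {xs. d \<le> Z xs})"
  proof (intro measure_pmf.finite_measure_mono_AE)
    \<comment> \<open>Rejection gives \<open>LU xs <= log b v + a\<close>, hence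
      \<open>Z xs >= ?L xs - a\<close>, which exceeds d once \<open>?L xs > a + d\<close>.\<close>
    have "?L xs \<le> a + d \<or> d \<le> Z xs"
      if xs: "xs \<in> set_pmf ?p" and less: "pmf ?p xs < v / (b powr (- a)) * pmf u xs" for xs
    proof -
      have "log b (pmf ?p xs) \<le> log b (v * b powr a * pmf u xs)"
        using less p0[OF xs] \<open>b > 1\<close> by (intro log_mono) (auto simp: powr_minus field_simps)
      also have "\<dots> = log b v + a + log b (pmf u xs)"
        using u0[OF xs] \<open>v > 0\<close> \<open>b > 1\<close> by (simp add: log_mult del: pmf_positive_iff)
      finally show ?thesis
        by (auto simp: Z_def LU_def)
    qed
    then show "AE xs in ?p. xs \<in> {xs. pmf ?p xs < v / (b powr (- a)) * pmf u xs} \<longrightarrow>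
        xs \<in> {xs. ?L xs \<le> a + d} \<union> {xs. d \<le> Z xs}"
      by (auto simp: AE_measure_pmf_iff)
  qed simp
  also have "\<dots> \<le> measure ?p {xs. ?L xs \<le> a + d} + measure ?p {xs. d \<le> Z xs}"
    by (intro measure_Un_le) auto
  also have "measure ?p {xs. d \<le> Z xs} \<le> measure_pmf.expectation ?p Z / d"
    using integral_Markov_inequality_measure[OF int, of "{}" Z d] Z0 \<open>d > 0\<close>
    by (simp add: AE_measure_pmf_iff)
  also have "\<dots> \<le> log b v / d"
    using EZ \<open>d > 0\<close> by (intro divide_right_mono) auto
  finally show ?thesis
    by simp
qed

section \<open>The second-order limit under the axioms\<close>

theorem theorem12:
  fixes P :: "'a::finite pmf"
    and Qn :: "nat \<Rightarrow> 'a list pmf set"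
    and \<Theta> :: "'v::euclidean_space set"
    and Q :: "'v \<Rightarrow> 'a pmf"
    and J :: "real set"
    and b r :: real
  assumes "b > 1"
    and "\<And>n. n \<ge> 1 \<Longrightarrow> Qn n \<subseteq> dists n"
    and "open J" "is_interval J" "1 \<in> J" "J \<subseteq> {0<..}"
    and "contains_products Qn"
    and "superadditive_div b J P Qn"
    and "has_universal_dist b J P Qn"
    and "regular_parametrization b J P (single_letter (Qn 1)) \<Theta> Q"
    and "info_variance_set b P (single_letter (Qn 1)) \<noteq> 0 \<or> r \<noteq> 0"
  shows "(\<lambda>n. opt_type1_error n
            (b powr (- real n * real_of_ereal (renyi_div_set b 1 P (single_letter (Qn 1))) - sqrt (real n) * r))
            (replicate_pmf n P) (Qn n))
         \<longlonglongrightarrow> gauss_cdf (ereal r / ereal (sqrt (info_variance_set b P (single_letter (Qn 1)))))"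
proof -
  define S where "S = single_letter (Qn 1)"
  have S: "S = Q ` \<Theta>"
    using assms(10) by (simp add: regular_parametrization_def S_def)
  obtain t where
      t_min: "\<And>t'. is_arg_min (\<lambda>\<theta>. renyi_div b 1 P (Q \<theta>)) (\<lambda>\<theta>. \<theta> \<in> \<Theta>) t' \<longleftrightarrow> t' = t"
      and t_rel: "t \<in> rel_interior \<Theta>"
      and hess: "pos_def_hessian (\<lambda>\<theta>. renyi_div b 1 P (Q \<theta>)) t \<Theta>"
    using assms(10) \<open>1 \<in> J\<close> unfolding regular_parametrization_def by blast
  have t: "t \<in> \<Theta>"
    using t_rel rel_interior_subset by blast
  define R where "R = Q t"
  have R: "R \<in> S"
    using t by (simp add: R_def S)
  \<comment> \<open>\<open>has_hessian_within\<close> demands real values on a ball around t, and t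
    is in that ball.\<close>
  have finite_div: "renyi_div b 1 P R \<noteq> \<infinity>"
    using hess t by (auto simp: pos_def_hessian_def has_hessian_within_def R_def)
  have pos: "pmf R x > 0" if "x \<in> set_pmf P" for x
    by (rule pmf_pos_if_renyi_div_1_finite[OF _ finite_div that]) simp
  define f where "f x = log b (pmf P x) - log b (pmf R x)" for x
  define m where "m = (\<Sum>x\<in>set_pmf P. pmf P x * f x)"
  define V where "V = (\<Sum>x\<in>set_pmf P. pmf P x * (f x - m)\<^sup>2)"
  have div: "renyi_div b 1 P R = ereal m"
    unfolding m_def f_def by (rule renyi_div_1_eq[OF pos])
  have least: "renyi_div b 1 P R \<le> renyi_div b 1 P R'" if "R' \<in> S" for R'
    using that t_min[of t] by (auto simp: is_arg_min_linorder S R_def)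
  have div_set: "renyi_div_set b 1 P S = ereal m"
    unfolding renyi_div_set_def div[symmetric]
    by (intro antisym INF_lower R INF_greatest least)
  \<comment> \<open>The variance is defined through a chosen minimizer among distributions. Every
    minimizing distribution has a minimizing parameter, which is t, so the choice can only be
    \<open>R\<close>.\<close>
  have "is_arg_min (\<lambda>Q. renyi_div b 1 P Q) (\<lambda>Q. Q \<in> S) R' \<longleftrightarrow> R' = R" for R'
  proof
    assume min: "is_arg_min (\<lambda>Q. renyi_div b 1 P Q) (\<lambda>Q. Q \<in> S) R'"
    then obtain t' where t': "t' \<in> \<Theta>" "R' = Q t'"
      by (auto simp: is_arg_min_linorder S)
    then have "is_arg_min (\<lambda>\<theta>. renyi_div b 1 P (Q \<theta>)) (\<lambda>\<theta>. \<theta> \<in> \<Theta>) t'"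
      using min by (auto simp: is_arg_min_linorder S)
    then show "R' = R"
      using t_min t'(2) by (simp add: R_def)
  qed (use least R in \<open>auto simp: is_arg_min_linorder\<close>)
  then have "arg_min (\<lambda>Q. renyi_div b 1 P Q) (\<lambda>Q. Q \<in> S) = R"
    by (simp add: arg_min_def)
  then have V: "info_variance_set b P S = V"
    by (simp add: info_variance_set_def info_variance_def div V_def f_def)
  have "V \<ge> 0"
    by (auto simp: V_def intro!: sum_nonneg)
  have Vr: "V \<noteq> 0 \<or> r \<noteq> 0"
    using assms(11) V by (simp add: S_def)
  obtain U :: "nat \<Rightarrow> 'a list pmf" and v :: "real poly" where
      U: "\<And>n. n \<ge> 1 \<Longrightarrow> U n \<in> sym_dists n"
      and dom: "\<And>n q xs. n \<ge> 1 \<Longrightarrow> q \<in> Qn n \<inter> sym_dists n \<Longrightarrow> xs \<in> words n \<Longrightarrow>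
        pmf q xs \<le> poly v (real n) * pmf (U n) xs"
      and Udiv: "\<And>n. n \<ge> 1 \<Longrightarrow>
        renyi_div b 1 (replicate_pmf n P) (U n) \<ge> renyi_div_set b 1 (replicate_pmf n P) (Qn n)"
      and symm: "\<And>n q. n \<ge> 1 \<Longrightarrow> q \<in> Qn n \<Longrightarrow> symmetrize n q \<in> Qn n \<inter> sym_dists n"
    using assms(9) \<open>1 \<in> J\<close> unfolding has_universal_dist_def by blast
  have Rn: "replicate_pmf n R \<in> Qn n \<inter> sym_dists n" if "n \<ge> 1" for n
    using assms(7) R that replicate_pmf_in_sym_dists
    by (auto simp: contains_products_def S_def)
  \<comment> \<open>Summing the domination of the product of \<open>R\<close> over all words
    compares total masses 1 and v(n). Thus log v(n) is nonnegative.\<close>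
  have v: "poly v (real n) \<ge> 1" if n: "n \<ge> 1" for n
  proof -
    have "1 = (\<Sum>xs\<in>words n. pmf (replicate_pmf n R) xs)"
      by (rule sum_pmf_words[OF replicate_pmf_in_dists, symmetric])
    also have "\<dots> \<le> (\<Sum>xs\<in>words n. poly v (real n) * pmf (U n) xs)"
      by (intro sum_mono dom n Rn)
    also have "\<dots> = poly v (real n)"
      using U[OF n] sum_pmf_words[of "U n" n] by (simp add: sym_dists_def flip: sum_distrib_left)
    finally show ?thesis .
  qed
  define \<mu> where "\<mu> n = b powr (- (real n * m + sqrt (real n) * r))" for n
  define F where "F n x = measure (replicate_pmf n P)
      {xs. (\<Sum>x\<leftarrow>xs. f x) \<le> real n * m + sqrt (real n) * x}" for n x
  \<comment> \<open>Both bounds use a = n * m + sqrt n * r and d = sqrt n *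
    \<open>\<epsilon>\<close>, so that a - d and a + d are the thresholds of \<open>F\<close> at
    \<open>r - \<epsilon>\<close> and \<open>r + \<epsilon>\<close>.\<close>
  have lower: "F n (r - \<epsilon>) - b powr (- (sqrt (real n) * \<epsilon>)) \<le>
      opt_type1_error n (\<mu> n) (replicate_pmf n P) (Qn n)" if n: "n \<ge> 1" for n \<epsilon>
    using opt_type1_error_product_ge[OF \<open>b > 1\<close> pos, of P n "Qn n"
        "real n * m + sqrt (real n) * r" "sqrt (real n) * \<epsilon>"] Rn[OF n]
    by (simp add: F_def \<mu>_def f_def algebra_simps)
  have upper: "opt_type1_error n (\<mu> n) (replicate_pmf n P) (Qn n) \<le>
      F n (r + \<epsilon>) + log b (poly v (real n)) / (sqrt (real n) * \<epsilon>)"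
    if n: "n \<ge> 1" and "\<epsilon> > 0" for n \<epsilon>
  proof -
    have "ereal (real n * m) \<le> renyi_div b 1 (replicate_pmf n P) (U n)"
    proof -
      have "ereal (real n * m) = ereal (real n) * renyi_div_set b 1 P S"
        by (simp add: div_set)
      also have "\<dots> \<le> renyi_div_set b 1 (replicate_pmf n P) (Qn n)"
        using assms(8) \<open>1 \<in> J\<close> n by (simp add: superadditive_div_def S_def)
      also have "\<dots> \<le> renyi_div b 1 (replicate_pmf n P) (U n)"
        by (rule Udiv[OF n])
      finally show ?thesis .
    qed
    then have "measure (replicate_pmf n P)
        {xs. pmf (replicate_pmf n P) xs < poly v (real n) / \<mu> n * pmf (U n) xs} \<le>
        F n (r + \<epsilon>) + log b (poly v (real n)) / (sqrt (real n) * \<epsilon>)"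
      using measure_universal_threshold_le[OF \<open>b > 1\<close> pos, of P n "poly v (real n)" "U n"
          "sqrt (real n) * \<epsilon>" "real n * m + sqrt (real n) * r"] dom[OF n Rn[OF n]] v[OF n] n \<open>\<epsilon> > 0\<close>
      by (simp add: F_def \<mu>_def f_def m_def algebra_simps)
    moreover have "opt_type1_error n (\<mu> n) (replicate_pmf n P) (Qn n) \<le> measure (replicate_pmf n P)
        {xs. pmf (replicate_pmf n P) xs < poly v (real n) / \<mu> n * pmf (U n) xs}"
      using v[OF n] Rn[OF n] assms(2)[OF n] symm[OF n] dom[OF n] \<open>b > 1\<close>
      by (intro opt_type1_error_le replicate_pmf_in_sym_dists U n) (auto simp: \<mu>_def)
    ultimately show ?thesis
      by linarith
  qed
  define \<rho> where "\<rho> = (if V = 0 then \<bar>r\<bar> else 1)"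
  have "(\<lambda>n. opt_type1_error n (\<mu> n) (replicate_pmf n P) (Qn n)) \<longlonglongrightarrow>
      gauss_cdf (ereal r / ereal (sqrt V))"
  proof (rule shifted_sandwich_tendsto[where F = F and \<rho> = \<rho>
        and G = "\<lambda>r. gauss_cdf (ereal r / ereal (sqrt V))"
        and l = "\<lambda>\<epsilon> n. b powr (- (sqrt (real n) * \<epsilon>))"
        and u = "\<lambda>\<epsilon> n. log b (poly v (real n)) / (sqrt (real n) * \<epsilon>)"])
    show "isCont (\<lambda>r. gauss_cdf (ereal r / ereal (sqrt V))) r"
      by (rule isCont_gauss_cdf_div[OF \<open>V \<ge> 0\<close> Vr])
    show "\<rho> > 0"
      using Vr by (simp add: \<rho>_def)
    show "(\<lambda>n. F n x) \<longlonglongrightarrow> gauss_cdf (ereal x / ereal (sqrt V))" if "dist x r < \<rho>" for x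
    proof -
      have "V \<noteq> 0 \<or> x \<noteq> 0"
        using that by (auto simp: \<rho>_def dist_real_def split: if_splits)
      then show ?thesis
        using replicate_pmf_central_limit_gauss_cdf[of P f x] by (simp add: F_def V_def m_def)
    qed
    show "\<forall>\<^sub>F n in sequentially. F n (r - \<epsilon>) - b powr (- (sqrt (real n) * \<epsilon>)) \<le>
        opt_type1_error n (\<mu> n) (replicate_pmf n P) (Qn n)" for \<epsilon>
      by (rule eventually_sequentiallyI[OF lower])
    show "\<forall>\<^sub>F n in sequentially. opt_type1_error n (\<mu> n) (replicate_pmf n P) (Qn n) \<le>
        F n (r + \<epsilon>) + log b (poly v (real n)) / (sqrt (real n) * \<epsilon>)" if "\<epsilon> > 0" for \<epsilon>
      by (rule eventually_sequentiallyI[OF upper[OF _ that]])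
    show "(\<lambda>n. b powr (- (sqrt (real n) * \<epsilon>))) \<longlonglongrightarrow> 0" if "\<epsilon> > 0" for \<epsilon>
      using that \<open>b > 1\<close> by real_asymp
    show "(\<lambda>n. log b (poly v (real n)) / (sqrt (real n) * \<epsilon>)) \<longlonglongrightarrow> 0" if "\<epsilon> > 0" for \<epsilon>
      by (rule log_poly_over_sqrt_tendsto_0[OF \<open>b > 1\<close> that v])
  qed
  then show ?thesis
    unfolding S_def[symmetric] V div_set by (simp add: \<mu>_def algebra_simps)
qed

end
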